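(* Let $C_d\geq 1$ denote the smallest constant such that \[\inf\left\{\|\psi\|_{L^\infty(\mathbb{T}^d)}\,:\, \psi\in L^\infty(\mathbb{T}^d),\ P\psi = \varphi\right\} \leq C_d \|\mathbf{H}_\varphi\|\] for every $\varphi$ in $H^2(\mathbb{T}^d)$. If $d$ is even, then \[C_d \geq \left(\frac{5\pi}{\pi+6\sqrt{3}}\right)^{\frac{d}{2}}.\]
   Context: $d\geq1$ is an integer and $\mathbb{T}^d$ is the $d$-dimensional torus with its normalized Haar measure. $H^2(\mathbb{T}^d)$ is the subspace of $L^2(\mathbb{T}^d)$ of functions whose Fourier coefficients are supported on $\mathbb{N}_0^d$, $\mathbb{N}_0=\{0,1,2,\ldots\}$, and $\overline{H^2}(\mathbb{T}^d)$ is the subspace of complex conjugates of functions in $H^2(\mathbb{T}^d)$. Let $P$ and $\overline{P}$ be the orthogonal projections from $L^2(\mathbb{T}^d)$ to $H^2(\mathbb{T}^d)$ and to $\overline{H^2}(\mathbb{T}^d)$, respectively. For $\varphi$ in $H^2(\mathbb{T}^d)$ the (small) Hankel operator $\mathbf{H}_\varphi$ from $H^2(\mathbb{T}^d)$ to $\overline{H^2}(\mathbb{T}^d)$ is $\mathbf{H}_\varphi f = \overline{P}(\overline{\varphi} f)$; it is initially defined for (analytic) polynomials $f$, and $\|\mathbf{H}_\varphi\|\in[0,\infty]$ denotes the supremum of $\|\mathbf{H}_\varphi f\|_{L^2}$ over polynomials $f$ with $\|f\|_{H^2}=1$. The inequality defining $C_d$ is only a condition for those $\varphi$ with $\|\mathbf{H}_\varphi\|<\infty$;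 the infimum of the empty set is $+\infty$. Thus the assertion is that any constant $C_d$ for which the inequality holds for all $\varphi$ satisfies the stated lower bound. *)

theory Defs
  imports "HOL-Probability.Probability"
begin

text \<open>
  Points of the \<open>d\<close>-dimensional torus are functions \<open>z\<close> on \<open>{..<d}\<close> with values in the unit circle.
\<close>

definition circle_measure :: "complex measure" where
  "circle_measure =
     distr (uniform_measure lborel {0..1::real}) (restrict_space borel (sphere 0 1))
       (\<lambda>t. cis (2 * pi * t))"

definition torus :: "nat \<Rightarrow> (nat \<Rightarrow> complex) measure" where
  "torus d = (\<Pi>\<^sub>M j\<in>{..<d}. circle_measure)"

text \<open>
  Elements of \<open>L\<^sup>2\<close> and \<open>L\<^sup>\<infinity>\<close> are represented by measurable functions; every notion below is
  invariant under changing these functions on null sets.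
\<close>

definition L2 :: "nat \<Rightarrow> ((nat \<Rightarrow> complex) \<Rightarrow> complex) set" where
  "L2 d = {f \<in> borel_measurable (torus d). integrable (torus d) (\<lambda>z. (cmod (f z))\<^sup>2)}"

definition L2_inner ::
  "nat \<Rightarrow> ((nat \<Rightarrow> complex) \<Rightarrow> complex) \<Rightarrow> ((nat \<Rightarrow> complex) \<Rightarrow> complex) \<Rightarrow> complex" where
  "L2_inner d f g = (LINT z|torus d. f z * cnj (g z))"

definition L2_norm :: "nat \<Rightarrow> ((nat \<Rightarrow> complex) \<Rightarrow> complex) \<Rightarrow> real" where
  "L2_norm d f = sqrt (LINT z|torus d. (cmod (f z))\<^sup>2)"

definition Linf_norm :: "nat \<Rightarrow> ((nat \<Rightarrow> complex) \<Rightarrow> complex) \<Rightarrow> ennreal" where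
  "Linf_norm d f = esssup (torus d) (\<lambda>z. ennreal (cmod (f z)))"

definition Linf :: "nat \<Rightarrow> ((nat \<Rightarrow> complex) \<Rightarrow> complex) set" where
  "Linf d = {f \<in> borel_measurable (torus d). Linf_norm d f < \<infinity>}"

definition fourier_coeff ::
  "nat \<Rightarrow> ((nat \<Rightarrow> complex) \<Rightarrow> complex) \<Rightarrow> (nat \<Rightarrow> int) \<Rightarrow> complex" where
  "fourier_coeff d f k = L2_inner d f (\<lambda>z. \<Prod>j<d. z j powi k j)"

definition H2 :: "nat \<Rightarrow> ((nat \<Rightarrow> complex) \<Rightarrow> complex) set" where
  "H2 d = {f \<in> L2 d. \<forall>k. (\<exists>j<d. k j < 0) \<longrightarrow> fourier_coeff d f k = 0}"

definition H2_conj :: "nat \<Rightarrow> ((nat \<Rightarrow> complex) \<Rightarrow> complex) set" where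
  "H2_conj d = (\<lambda>f z. cnj (f z)) ` H2 d"

text \<open>
  \<open>g\<close> represents the orthogonal projection of \<open>f\<close> onto the subspace \<open>S\<close>.  For \<open>f \<in> L2 d\<close> and closed
  \<open>S\<close> such a \<open>g\<close> exists and is unique almost everywhere.
\<close>

definition is_orth_proj ::
  "nat \<Rightarrow> ((nat \<Rightarrow> complex) \<Rightarrow> complex) set \<Rightarrow> ((nat \<Rightarrow> complex) \<Rightarrow> complex)
     \<Rightarrow> ((nat \<Rightarrow> complex) \<Rightarrow> complex) \<Rightarrow> bool" where
  "is_orth_proj d S f g \<longleftrightarrow> g \<in> S \<and> (\<forall>h\<in>S. L2_inner d (\<lambda>z. f z - g z) h = 0)"

definition analytic_polys :: "nat \<Rightarrow> ((nat \<Rightarrow> complex) \<Rightarrow> complex) set" where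
  "analytic_polys d =
     {f. \<exists>(K :: (nat \<Rightarrow> nat) set) c. finite K \<and> f = (\<lambda>z. \<Sum>k\<in>K. c k * (\<Prod>j<d. z j ^ k j))}"

definition hankel ::
  "nat \<Rightarrow> ((nat \<Rightarrow> complex) \<Rightarrow> complex) \<Rightarrow> ((nat \<Rightarrow> complex) \<Rightarrow> complex)
     \<Rightarrow> (nat \<Rightarrow> complex) \<Rightarrow> complex" where
  "hankel d \<phi> f = (SOME g. is_orth_proj d (H2_conj d) (\<lambda>z. cnj (\<phi> z) * f z) g)"

definition hankel_norm :: "nat \<Rightarrow> ((nat \<Rightarrow> complex) \<Rightarrow> complex) \<Rightarrow> ennreal" where
  "hankel_norm d \<phi> =
     (SUP f \<in> {f \<in> analytic_polys d. L2_norm d f = 1}. ennreal (L2_norm d (hankel d \<phi> f)))"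

definition min_symbol_norm :: "nat \<Rightarrow> ((nat \<Rightarrow> complex) \<Rightarrow> complex) \<Rightarrow> ennreal" where
  "min_symbol_norm d \<phi> = (INF \<psi> \<in> {\<psi> \<in> Linf d. is_orth_proj d (H2 d) \<psi> \<phi>}. Linf_norm d \<psi>)"

text \<open>
  The constraint \<open>C \<ge> 1\<close> need not be imposed: for \<open>\<phi> = 1\<close> both quantities equal \<open>1\<close>.  If no finite
  constant is admissible, the value is \<open>\<infinity>\<close>.
\<close>

definition nehari_const :: "nat \<Rightarrow> ennreal" where
  "nehari_const d =
     Inf {C. \<forall>\<phi>\<in>H2 d. hankel_norm d \<phi> < \<infinity> \<longrightarrow> min_symbol_norm d \<phi> \<le> C * hankel_norm d \<phi>}"

end

theory Submission
  imports Defs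
begin

text \<open>
  For \<open>d = 2\<close> take \<open>\<phi>(x, y) = 2x\<^sup>2 + xy + 2y\<^sup>2\<close> and \<open>q(x, y) = x\<^sup>2 + xy + y\<^sup>2\<close>. Every bounded \<open>\<psi>\<close> with
  \<open>P\<psi> = \<phi>\<close> has the same inner product with \<open>q\<close> as \<open>\<phi>\<close>, namely \<open>5\<close>, so its norm is at least
  \<open>5 / \<parallel>q\<parallel>\<close> with the \<open>L\<^sup>1\<close> norm \<open>\<parallel>q\<parallel> = (\<pi> + 6\<surd>3) / (3\<pi>)\<close>, the mean of \<open>\<bar>1 + 2 cos \<theta>\<bar>\<close>. The matrix
  of the Hankel operator of \<open>\<phi>\<close> has nonnegative entries, and the Schur test with its positive
  eigenvector shows that its norm is at most \<open>3\<close>. For \<open>d = 2m\<close> take products of \<open>m\<close> copies of \<open>\<phi>\<close> and of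
  \<open>q\<close> in separate pairs of variables: inner product and \<open>L\<^sup>1\<close> norm are multiplicative, and so are the
  weights in the Schur test.
\<close>

subsection \<open>The torus and its monomials\<close>

lemma circle_param_measurable [measurable]:
  "(\<lambda>t. cis (2 * pi * t)) \<in> lborel \<rightarrow>\<^sub>M restrict_space borel (sphere 0 1)"
proof (rule measurable_restrict_space2)
  have "continuous_on UNIV (\<lambda>t::real. cis (2 * pi * t))"
    by (intro continuous_intros)
  then show "(\<lambda>t. cis (2 * pi * t)) \<in> lborel \<rightarrow>\<^sub>M borel"
    by (simp add: borel_measurable_continuous_onI)
qed simp

text \<open>The interval has mass 1, so no normalizing factor remains. In density form, integrals
  over the circle turn into set integrals over [0, 1].\<close>

lemma uniform_unit_interval:
  "uniform_measure lborel {0..1::real} = density lborel (\<lambda>t. ennreal (indicator {0..1} t))"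
  unfolding uniform_measure_def
  by (intro density_cong) (auto simp: divide_ennreal_def ennreal_indicator)

lemma sets_circle: "sets circle_measure = sets (restrict_space borel (sphere 0 1))"
  and space_circle: "space circle_measure = sphere 0 1"
  by (simp_all add: circle_measure_def space_restrict_space)

lemma prob_space_circle: "prob_space circle_measure"
proof -
  have "prob_space (uniform_measure lborel {0..1::real})"
    by (rule prob_space_uniform_measure) auto
  then show ?thesis
    unfolding circle_measure_def
    by (rule prob_space.prob_space_distr) (simp add: uniform_unit_interval)
qed

interpretation circle: prob_space circle_measure
  by (rule prob_space_circle)

interpretation torus_fam: product_sigma_finite "\<lambda>_::nat. circle_measure"
  by unfold_locales

lemma prob_space_torus: "prob_space (torus d)"
  unfolding torus_def by (rule prob_space_PiM) (rule prob_space_circle)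

lemma borel_circle: "f \<in> borel_measurable borel \<Longrightarrow> f \<in> borel_measurable circle_measure"
  by (simp add: measurable_restrict_space1 cong: measurable_cong_sets[OF sets_circle])

lemma integral_circle:
  fixes h :: "complex \<Rightarrow> 'a::{banach, second_countable_topology}"
  assumes "h \<in> borel_measurable borel"
  shows "integral\<^sup>L circle_measure h = (LINT t:{0..1}|lborel. h (cis (2 * pi * t)))"
proof -
  have h: "h \<in> borel_measurable (restrict_space borel (sphere 0 1))"
    using assms by (rule measurable_restrict_space1)
  have m: "(\<lambda>t. h (cis (2 * pi * t))) \<in> borel_measurable lborel"
    by (rule measurable_compose[OF circle_param_measurable h])
  have "integral\<^sup>L circle_measure h =
      integral\<^sup>L (density lborel (\<lambda>t. ennreal (indicator {0..1} t))) (\<lambda>t. h (cis (2 * pi * t)))"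
    unfolding circle_measure_def uniform_unit_interval
    using h by (subst integral_distr) auto
  also have "\<dots> = (LINT t:{0..1}|lborel. h (cis (2 * pi * t)))"
    using m by (subst integral_density) (auto simp: set_lebesgue_integral_def)
  finally show ?thesis .
qed

lemma torus_coord_norm: "z \<in> space (torus d) \<Longrightarrow> j < d \<Longrightarrow> cmod (z j) = 1"
  by (auto simp: torus_def space_PiM space_circle PiE_iff)

lemma torus_coord_measurable [measurable]:
  "j < d \<Longrightarrow> (\<lambda>z. z j) \<in> borel_measurable (torus d)"
  unfolding torus_def
  by (rule measurable_compose[OF measurable_component_singleton]) (auto intro: borel_circle)

lemma powi_borel [measurable]: "(\<lambda>z::complex. z powi k) \<in> borel_measurable borel"
  by (cases "k \<ge> 0") (simp_all add: power_int_def)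

lemma integral_circle_powi:
  "integral\<^sup>L circle_measure (\<lambda>z. z powi k) = (if k = 0 then 1 else 0)"
proof (cases "k = 0")
  case True
  then show ?thesis by (simp add: circle.prob_space)
next
  case False
  define A where "A = 2 * pi * k * \<i>"
  define F where "F t = exp (t *\<^sub>R A) / A" for t :: real
  have A: "A \<noteq> 0" using False by (simp add: A_def)
  have e: "cis (2 * pi * t) powi k = exp (t *\<^sub>R A)" for t
    by (simp only: cis_power_int) (simp add: A_def cis_conv_exp scaleR_conv_of_real mult_ac)
  have "(F has_vector_derivative cis (2 * pi * t) powi k) (at t within {0..1})" for t
  proof -
    have "(F has_vector_derivative (exp (t *\<^sub>R A) * A) / A) (at t within {0..1})"
      unfolding F_def
      by (intro has_vector_derivative_divide exp_scaleR_has_vector_derivative_right)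
    then show ?thesis using A by (simp add: e)
  qed
  moreover have "continuous_on {0..1} (\<lambda>t. cis (2 * pi * t) powi k)"
    by (intro continuous_intros) auto
  ultimately have "(LINT t:{0..1}|lborel. cis (2 * pi * t) powi k) = F 1 - F 0"
    unfolding set_lebesgue_integral_def
    using integral_FTC_Icc[of 0 1 F "\<lambda>t. cis (2 * pi * t) powi k"] by simp
  \<comment> \<open>\<open>e\<close> at 1 gives \<open>exp A = cis (2 * pi) powi k = 1\<close>, so
    the antiderivative takes the same value at both endpoints.\<close>
  also have "\<dots> = 0"
    using e[of 1] by (simp add: F_def)
  finally show ?thesis using False by (simp add: integral_circle)
qed

text \<open>With integer exponents the monomials are closed under products and, on the torus, under
  conjugation. The integrand of an inner product of two monomials is then again a single
  monomial.\<close>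

definition monom_fun :: "nat \<Rightarrow> (nat \<Rightarrow> int) \<Rightarrow> (nat \<Rightarrow> complex) \<Rightarrow> complex" where
  "monom_fun d k z = (\<Prod>j<d. z j powi k j)"

lemma monom_fun_measurable [measurable]: "monom_fun d k \<in> borel_measurable (torus d)"
  unfolding monom_fun_def by (rule borel_measurable_prod) auto

lemma norm_monom_fun: "z \<in> space (torus d) \<Longrightarrow> cmod (monom_fun d k z) = 1"
  by (auto simp: monom_fun_def prod_norm[symmetric] norm_power_int torus_coord_norm intro!: prod.neutral)

lemma monom_fun_mult:
  "z \<in> space (torus d) \<Longrightarrow> monom_fun d k z * monom_fun d l z = monom_fun d (\<lambda>j. k j + l j) z"
  unfolding monom_fun_def prod.distrib[symmetric]
  by (rule prod.cong) (auto intro!: power_int_add[symmetric] dest!: torus_coord_norm)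

lemma cnj_monom_fun:
  assumes "z \<in> space (torus d)"
  shows "cnj (monom_fun d k z) = monom_fun d (\<lambda>j. - k j) z"
proof -
  have "cnj (z j) = inverse (z j)" if "j < d" for j
    using torus_coord_norm[OF assms that] by (simp add: inverse_complex_def complex_eq_iff cmod_def)
  then show ?thesis
    unfolding monom_fun_def by (auto simp: power_int_minus power_int_inverse intro!: prod.cong)
qed

lemma integrable_torus_bounded:
  fixes f :: "(nat \<Rightarrow> complex) \<Rightarrow> 'a::{banach, second_countable_topology}"
  assumes "f \<in> borel_measurable (torus d)" "\<And>z. z \<in> space (torus d) \<Longrightarrow> norm (f z) \<le> b"
  shows "integrable (torus d) f"
proof -
  interpret prob_space "torus d" by (rule prob_space_torus)
  show ?thesis
    using assms by (intro integrable_const_bound[where B = b]) auto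
qed

lemma integral_monom_fun:
  "(LINT z|torus d. monom_fun d k z) = (if \<forall>j<d. k j = 0 then 1 else 0)"
proof -
  have "integrable circle_measure (\<lambda>z. z powi k j)" for j
    by (intro circle.integrable_const_bound[where B = 1] AE_I2 borel_circle)
      (auto simp: space_circle norm_power_int)
  then have "(LINT z|torus d. monom_fun d k z) = (\<Prod>j<d. if k j = 0 then 1 else 0)"
    unfolding torus_def monom_fun_def
    by (subst torus_fam.product_integral_prod) (auto simp: integral_circle_powi)
  then show ?thesis by (auto simp: prod_zero_iff)
qed

subsection \<open>The \<open>L\<^sup>1\<close> norm of the test polynomial\<close>

text \<open>The shift moves [0, 1] to [-s, 1 - s]. Cutting at 0 and translating the piece [-s, 0] by
  one period to [1 - s, 1] restores the unit interval.\<close>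

lemma periodic_integral:
  fixes g :: "real \<Rightarrow> real"
  assumes "continuous_on UNIV g" "\<And>t. g (t + 1) = g t" "0 \<le> s" "s \<le> 1"
  shows "integral {0..1} (\<lambda>t. g (t - s)) = integral {0..1} g"
proof -
  have i: "g integrable_on {u..v}" for u v
    using assms(1) continuous_on_subset integrable_continuous_real by blast
  have "integral {0..1} (\<lambda>t. g (t - s)) = integral {-s..1 - s} g"
    using integral_shift_real_ivl[where f = g and a = "-s" and b = "1 - s" and c = "-s"] by (simp add: algebra_simps)
  also have "\<dots> = integral {-s..0} g + integral {0..1 - s} g"
    using assms by (intro Henstock_Kurzweil_Integration.integral_combine[symmetric] i) auto
  also have "integral {-s..0} g = integral {1 - s..1} g"
    using integral_shift_real_ivl[where f = g and a = "1 - s" and b = 1 and c = 1] assms(2) by simp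
  also have "integral {1 - s..1} g + integral {0..1 - s} g = integral {0..1} g"
    using assms by (subst add.commute) (intro Henstock_Kurzweil_Integration.integral_combine i; simp)
  finally show ?thesis .
qed

text \<open>The integrand without the absolute value changes sign where the cosine is -1/2, at t =
  1/3 and t = 2/3. On each third the antiderivative \<open>F\<close> applies up to sign, which gives
  2 F(1/3) - F(0) - 2 F(2/3) + F(1).\<close>

lemma integral_abs_dirichlet:
  "integral {0..1} (\<lambda>t. \<bar>1 + 2 * cos (2 * pi * t)\<bar>) = (pi + 6 * sqrt 3) / (3 * pi)"
proof -
  define F where "F t = t + sin (2 * pi * t) / pi" for t :: real
  define g where "g t = 1 + 2 * cos (2 * pi * t)" for t :: real
  have F: "(F has_vector_derivative g t) (at t within S)" for t S
    unfolding F_def g_def has_real_derivative_iff_has_vector_derivative[symmetric]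
    by (auto intro!: derivative_eq_intros)
  have pos: "\<bar>g t\<bar> = g t" if "0 \<le> t" "t \<le> 1/3" for t
  proof -
    have "cos (2 * pi / 3) \<le> cos (2 * pi * t)"
      using that by (intro cos_monotone_0_pi_le) (auto simp: field_simps)
    then show ?thesis by (simp add: g_def cos_120)
  qed
  have sym: "g (1 - t) = g t" for t
  proof -
    have "cos (2 * pi * (1 - t)) = cos (2 * pi - 2 * pi * t)" by (simp add: algebra_simps)
    then show ?thesis by (simp add: g_def cos_diff)
  qed
  have neg: "\<bar>g t\<bar> = - g t" if "1/3 \<le> t" "t \<le> 2/3" for t
  proof -
    \<comment> \<open>The cosine is monotone on [0, \<pi>] only, which means t \<le> 1/2. The
      reflection \<open>sym\<close> carries the result to the other half.\<close>
    have *: "\<bar>g t\<bar> = - g t" if "1/3 \<le> t" "t \<le> 1/2" for t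
    proof -
      have "cos (2 * pi * t) \<le> cos (2 * pi / 3)"
        using that by (intro cos_monotone_0_pi_le) (auto simp: field_simps)
      then show ?thesis by (simp add: g_def cos_120)
    qed
    show ?thesis
      using *[of t] *[of "1 - t"] that by (cases "t \<le> 1/2") (auto simp: sym)
  qed
  have F13: "F (1/3) = 1/3 + sqrt 3 / (2 * pi)"
    by (simp add: F_def sin_120)
  have "sin (4 * pi / 3) = sin (2 * pi - 2 * pi / 3)" by (rule arg_cong[where f = sin]) simp
  also have "\<dots> = - sqrt 3 / 2" by (simp only: sin_diff) (simp add: sin_120)
  finally have F23: "F (2/3) = 2/3 - sqrt 3 / (2 * pi)"
    by (simp add: F_def)
  have i1: "((\<lambda>t. \<bar>g t\<bar>) has_integral F (1/3) - F 0) {0..1/3}"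
    by (rule has_integral_eq[of _ g]) (auto simp: pos intro!: fundamental_theorem_of_calculus F)
  have i2: "((\<lambda>t. \<bar>g t\<bar>) has_integral - (F (2/3) - F (1/3))) {1/3..2/3}"
    by (rule has_integral_eq[of _ "\<lambda>t. - g t"])
      (auto simp: neg intro!: has_integral_neg fundamental_theorem_of_calculus F simp del: minus_diff_eq)
  have pos': "\<bar>g t\<bar> = g t" if "2/3 \<le> t" "t \<le> 1" for t
    using pos[of "1 - t"] that by (simp add: sym)
  have i3: "((\<lambda>t. \<bar>g t\<bar>) has_integral F 1 - F (2/3)) {2/3..1}"
    by (rule has_integral_eq[of _ g]) (auto simp: pos' intro!: fundamental_theorem_of_calculus F)
  have "((\<lambda>t. \<bar>g t\<bar>) has_integral
      (F (1/3) - F 0 + - (F (2/3) - F (1/3)) + (F 1 - F (2/3)))) {0..1}"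
    by (rule has_integral_combine[OF _ _ has_integral_combine[OF _ _ i1 i2] i3]) auto
  moreover have "F (1/3) - F 0 + - (F (2/3) - F (1/3)) + (F 1 - F (2/3)) = (pi + 6 * sqrt 3) / (3 * pi)"
    unfolding F13 F23 by (simp add: F_def field_simps)
  ultimately show ?thesis by (simp add: g_def has_integral_iff)
qed

text \<open>With u = y / x the polynomial is \<open>x^2 * (1 + u + u^2)\<close>, and
  \<open>1 + u + u^2 = u * (1 + u + cnj u)\<close> has modulus |1 + 2 cos \<theta>|, where \<theta>
  is the argument of u. By periodicity the integral over y is the same for every x on the
  circle.\<close>

lemma integral_circle_norm_quadratic:
  assumes "cmod x = 1"
  shows "(LINT y|circle_measure. cmod (x\<^sup>2 + x * y + y\<^sup>2)) = (pi + 6 * sqrt 3) / (3 * pi)"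
proof -
  obtain s where s: "0 \<le> s" "s \<le> 1" "x = cis (2 * pi * s)"
  proof
    have "x = cis (Arg2pi x)"
      using assms Arg2pi[of x] by (simp add: cis_conv_exp is_Arg_def)
    then show "x = cis (2 * pi * (Arg2pi x / (2 * pi)))" by simp
    show "0 \<le> Arg2pi x / (2 * pi)" "Arg2pi x / (2 * pi) \<le> 1"
      using Arg2pi_ge_0[of x] Arg2pi_lt_2pi[of x] by (auto simp: field_simps)
  qed
  define g where "g t = \<bar>1 + 2 * cos (2 * pi * t)\<bar>" for t :: real
  have norm: "cmod (x\<^sup>2 + x * cis (2 * pi * t) + (cis (2 * pi * t))\<^sup>2) = g (t - s)" for t
  proof -
    define u where "u = cis (2 * pi * (t - s))"
    have u: "cis (2 * pi * t) = x * u"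
      by (simp add: u_def s cis_mult algebra_simps)
    have "1 + u + u\<^sup>2 = u * of_real (1 + 2 * cos (2 * pi * (t - s)))"
    proof -
      have "u * cnj u = 1" by (simp add: u_def cis_cnj cis_mult)
      moreover have "complex_of_real (2 * cos (2 * pi * (t - s))) = u + cnj u"
        by (simp add: u_def complex_eq_iff)
      ultimately show ?thesis by (simp add: algebra_simps power2_eq_square)
    qed
    moreover have "x\<^sup>2 + x * cis (2 * pi * t) + (cis (2 * pi * t))\<^sup>2 = x\<^sup>2 * (1 + u + u\<^sup>2)"
      unfolding u by (simp add: algebra_simps power2_eq_square)
    ultimately show ?thesis
      using assms by (simp only: norm_mult norm_power norm_of_real g_def) (simp add: u_def)
  qed
  have c: "continuous_on UNIV g" unfolding g_def by (intro continuous_intros)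
  have p: "g (t + 1) = g t" for t by (simp add: g_def distrib_left cos_add)
  have "(LINT y|circle_measure. cmod (x\<^sup>2 + x * y + y\<^sup>2)) = (LINT t:{0..1}|lborel. g (t - s))"
    by (subst integral_circle) (simp_all add: norm)
  also have "\<dots> = integral {0..1} (\<lambda>t. g (t - s))"
  proof (rule set_borel_integral_eq_integral(2))
    show "set_integrable lborel {0..1} (\<lambda>t. g (t - s))"
      by (intro borel_integrable_atLeastAtMost')
        (auto intro!: continuous_on_compose2[OF c] continuous_intros)
  qed
  also have "\<dots> = integral {0..1} g"
    by (rule periodic_integral[OF c p s(1,2)])
  finally show ?thesis using integral_abs_dirichlet by (simp add: g_def[abs_def])
qed

section \<open>Products over disjoint pairs of variables\<close>

definition pair_prod :: "nat \<Rightarrow> ('a \<Rightarrow> 'a \<Rightarrow> 'b::comm_monoid_mult) \<Rightarrow> (nat \<Rightarrow> 'a) \<Rightarrow> 'b" where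
  "pair_prod m F z = (\<Prod>i<m. F (z (2 * i)) (z (2 * i + 1)))"

lemma pair_prod_Suc: "pair_prod (Suc m) F z = pair_prod m F z * F (z (2 * m)) (z (2 * m + 1))"
  by (simp add: pair_prod_def)

lemma pair_prod_upd: "2 * m \<le> j \<Longrightarrow> pair_prod m F (z(j := y)) = pair_prod m F z"
  unfolding pair_prod_def by (rule prod.cong) auto

text \<open>Fubini in two steps for each pair: the integral over coordinate 2m + 1 is c whatever
  coordinate 2m is, after which coordinate 2m no longer occurs and contributes total mass 1. The
  intermediate product lives on a torus of odd dimension, hence \<open>meas'\<close>;
  \<open>bound\<close> supplies integrability.\<close>

lemma integral_torus_pair_prod:
  fixes F :: "complex \<Rightarrow> complex \<Rightarrow> real"
  assumes meas: "\<And>m. pair_prod m F \<in> borel_measurable (torus (2 * m))"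
    and meas': "\<And>m. pair_prod m F \<in> borel_measurable (torus (Suc (2 * m)))"
    and bound: "\<And>x y. cmod x = 1 \<Longrightarrow> cmod y = 1 \<Longrightarrow> \<bar>F x y\<bar> \<le> b"
    and inner: "\<And>x. cmod x = 1 \<Longrightarrow> (LINT y|circle_measure. F x y) = c"
  shows "(LINT z|torus (2 * m). pair_prod m F z) = c ^ m"
proof (induction m)
  case 0
  interpret prob_space "torus 0" by (rule prob_space_torus)
  show ?case by (simp add: pair_prod_def prob_space)
next
  case (Suc m)
  have le: "\<bar>pair_prod k F z\<bar> \<le> b ^ k" if "z \<in> space (torus n)" "2 * k \<le> n" for z k n
  proof -
    have "\<bar>pair_prod k F z\<bar> \<le> (\<Prod>i<k. b)"
      unfolding pair_prod_def abs_prod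
      using that by (intro prod_mono) (auto intro!: bound torus_coord_norm)
    then show ?thesis by simp
  qed
  have ins1: "{..<2 * Suc m} = insert (Suc (2 * m)) {..<Suc (2 * m)}" by auto
  have ins2: "{..<Suc (2 * m)} = insert (2 * m) {..<2 * m}" by auto
  have int1: "integrable (torus (2 * Suc m)) (pair_prod (Suc m) F)"
    by (rule integrable_torus_bounded[OF meas]) (unfold real_norm_def, rule le, auto)
  have int2: "integrable (torus (Suc (2 * m))) (pair_prod m F)"
    by (rule integrable_torus_bounded[OF meas']) (unfold real_norm_def, rule le, auto)
  have "(LINT z|torus (2 * Suc m). pair_prod (Suc m) F z) =
      (LINT z|torus (Suc (2 * m)). LINT y|circle_measure. pair_prod (Suc m) F (z(Suc (2 * m) := y)))"
    using int1 unfolding torus_def ins1 by (intro torus_fam.product_integral_insert) auto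
  also have "\<dots> = (LINT z|torus (Suc (2 * m)). pair_prod m F z * c)"
    by (rule Bochner_Integration.integral_cong)
      (auto simp: pair_prod_Suc pair_prod_upd inner torus_coord_norm)
  also have "\<dots> = (LINT z|torus (Suc (2 * m)). pair_prod m F z) * c"
    by simp
  also have "(LINT z|torus (Suc (2 * m)). pair_prod m F z) =
      (LINT z|torus (2 * m). LINT y|circle_measure. pair_prod m F (z(2 * m := y)))"
    using int2 unfolding torus_def ins2 by (intro torus_fam.product_integral_insert) auto
  also have "\<dots> = (LINT z|torus (2 * m). pair_prod m F z)"
    by (simp add: pair_prod_upd circle.prob_space)
  finally show ?case by (simp add: Suc.IH)
qed

subsection \<open>Finite sums and the Schur test\<close>

lemma sum_PiE_insert:
  assumes "x \<notin> S"
  shows "sum f (PiE (insert x S) T) = (\<Sum>y\<in>T x. \<Sum>g\<in>PiE S T. f (g(x := y)))"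
proof -
  have "sum f (PiE (insert x S) T) = (\<Sum>(y, g)\<in>T x \<times> PiE S T. f (g(x := y)))"
    unfolding PiE_insert_eq
    by (subst sum.reindex) (use assms inj_combinator in \<open>auto simp: o_def case_prod_unfold\<close>)
  then show ?thesis by (simp add: sum.cartesian_product)
qed

text \<open>Distributivity with the two exponents of a pair kept together; the induction splits off
  both coordinates of the last pair. This makes the finite sums over the box of exponents
  multiplicative.\<close>

lemma sum_prod_pairs:
  fixes F :: "nat \<Rightarrow> 'b \<Rightarrow> 'b \<Rightarrow> 'a::comm_semiring_1"
  shows "(\<Sum>e\<in>{..<2 * m} \<rightarrow>\<^sub>E A. \<Prod>i<m. F i (e (2 * i)) (e (2 * i + 1))) =
    (\<Prod>i<m. \<Sum>x\<in>A. \<Sum>y\<in>A. F i x y)"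
proof (induction m)
  case (Suc m)
  have ins: "{..<2 * Suc m} = insert (Suc (2 * m)) (insert (2 * m) {..<2 * m})" by auto
  have "(\<Prod>i<m. F i ((e(2 * m := x, Suc (2 * m) := y)) (2 * i))
      ((e(2 * m := x, Suc (2 * m) := y)) (2 * i + 1))) = (\<Prod>i<m. F i (e (2 * i)) (e (2 * i + 1)))"
    for e x y by (rule prod.cong) auto
  then have "(\<Sum>e\<in>{..<2 * Suc m} \<rightarrow>\<^sub>E A. \<Prod>i<Suc m. F i (e (2 * i)) (e (2 * i + 1))) =
      (\<Sum>y\<in>A. \<Sum>x\<in>A. \<Sum>e\<in>{..<2 * m} \<rightarrow>\<^sub>E A. (\<Prod>i<m. F i (e (2 * i)) (e (2 * i + 1))) * F m x y)"
    unfolding ins by (simp add: sum_PiE_insert)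
  also have "\<dots> = (\<Prod>i<Suc m. \<Sum>x\<in>A. \<Sum>y\<in>A. F i x y)"
    using Suc.IH
    by (subst sum.swap) (simp add: sum_distrib_right[symmetric] sum_distrib_left[symmetric])
  finally show ?case .
qed simp

lemma prod_even_odd:
  fixes m :: nat
  shows "(\<Prod>j<2 * m. f j) = (\<Prod>i<m. f (2 * i) * f (2 * i + 1))"
  by (induction m) (simp_all add: mult_ac)

text \<open>Cauchy-Schwarz after writing A as \<open>sqrt (A * w) * sqrt (A / w)\<close>. The row
  bound controls the first factor; swapping the sums and applying the column bound controls the
  second.\<close>

lemma schur_test:
  fixes A :: "'a \<Rightarrow> 'b \<Rightarrow> real"
  assumes A: "\<And>n k. n \<in> J \<Longrightarrow> k \<in> K \<Longrightarrow> 0 \<le> A n k"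
    and w: "\<And>k. k \<in> K \<Longrightarrow> 0 < w k" and "0 \<le> L"
    and row: "\<And>n. n \<in> J \<Longrightarrow> (\<Sum>k\<in>K. A n k * w k) \<le> L * v n"
    and col: "\<And>k. k \<in> K \<Longrightarrow> (\<Sum>n\<in>J. A n k * v n) \<le> L * w k"
  shows "(\<Sum>n\<in>J. (\<Sum>k\<in>K. A n k * x k)\<^sup>2) \<le> L\<^sup>2 * (\<Sum>k\<in>K. (x k)\<^sup>2)"
proof -
  have "(\<Sum>k\<in>K. A n k * x k)\<^sup>2 \<le> L * v n * (\<Sum>k\<in>K. A n k * ((x k)\<^sup>2 / w k))" if n: "n \<in> J" for n
  proof -
    have "(\<Sum>k\<in>K. A n k * x k) = (\<Sum>k\<in>K. sqrt (A n k * w k) * (sqrt (A n k / w k) * x k))"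
    proof (rule sum.cong[OF refl])
      fix k assume k: "k \<in> K"
      have "sqrt (A n k * w k) * sqrt (A n k / w k) = A n k"
        using A[OF n k] w[OF k] by (simp add: real_sqrt_mult[symmetric])
      then show "A n k * x k = sqrt (A n k * w k) * (sqrt (A n k / w k) * x k)"
        by (simp add: mult.assoc[symmetric])
    qed
    also have "(\<dots>)\<^sup>2 \<le> (\<Sum>k\<in>K. (sqrt (A n k * w k))\<^sup>2) * (\<Sum>k\<in>K. (sqrt (A n k / w k) * x k)\<^sup>2)"
      by (rule Cauchy_Schwarz_ineq_sum)
    also have "\<dots> = (\<Sum>k\<in>K. A n k * w k) * (\<Sum>k\<in>K. A n k * ((x k)\<^sup>2 / w k))"
      using A[OF n] w by (auto simp: power_mult_distrib less_imp_le intro!: arg_cong2[where f = "(*)"] sum.cong)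
    also have "\<dots> \<le> L * v n * (\<Sum>k\<in>K. A n k * ((x k)\<^sup>2 / w k))"
      using A[OF n] w by (intro mult_right_mono row n sum_nonneg) (auto simp: less_imp_le)
    finally show ?thesis .
  qed
  then have "(\<Sum>n\<in>J. (\<Sum>k\<in>K. A n k * x k)\<^sup>2) \<le>
      (\<Sum>n\<in>J. \<Sum>k\<in>K. L * v n * (A n k * ((x k)\<^sup>2 / w k)))"
    by (simp add: sum_mono sum_distrib_left)
  also have "\<dots> = (\<Sum>k\<in>K. L * ((x k)\<^sup>2 / w k) * (\<Sum>n\<in>J. A n k * v n))"
    by (subst sum.swap) (simp add: sum_distrib_left sum_divide_distrib mult_ac)
  also have "\<dots> \<le> (\<Sum>k\<in>K. L * ((x k)\<^sup>2 / w k) * (L * w k))"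
    using w \<open>0 \<le> L\<close> by (intro sum_mono mult_left_mono col) (auto simp: less_imp_le)
  also have "\<dots> = L\<^sup>2 * (\<Sum>k\<in>K. (x k)\<^sup>2)"
  proof -
    have "L * ((x k)\<^sup>2 / w k) * (L * w k) = L\<^sup>2 * (x k)\<^sup>2" if "k \<in> K" for k
      using w[OF that] by (simp add: power2_eq_square)
    then show ?thesis by (simp add: sum_distrib_left)
  qed
  finally show ?thesis .
qed

subsection \<open>Polynomials in \<open>L\<^sup>2\<close>\<close>

lemma cnj_borel [measurable]: "cnj \<in> borel_measurable borel"
  by (intro borel_measurable_continuous_onI continuous_intros)

lemma monom_fun_cong: "(\<And>j. j < d \<Longrightarrow> k j = l j) \<Longrightarrow> monom_fun d k = monom_fun d l"
  unfolding monom_fun_def by (intro ext prod.cong) auto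

lemma fourier_coeff_alt: "fourier_coeff d f k = L2_inner d f (monom_fun d k)"
  unfolding fourier_coeff_def monom_fun_def ..

lemma L2_bounded:
  assumes "f \<in> borel_measurable (torus d)" "\<And>z. z \<in> space (torus d) \<Longrightarrow> cmod (f z) \<le> b"
  shows "f \<in> L2 d"
  using assms unfolding L2_def
  by (auto intro!: integrable_torus_bounded[where b = "b\<^sup>2"] power_mono)

lemma L2_inner_integrable:
  assumes "f \<in> L2 d" "g \<in> L2 d"
  shows "integrable (torus d) (\<lambda>z. f z * cnj (g z))"
proof (rule Bochner_Integration.integrable_bound)
  show "integrable (torus d) (\<lambda>z. (cmod (f z))\<^sup>2 + (cmod (g z))\<^sup>2)"
    and "(\<lambda>z. f z * cnj (g z)) \<in> borel_measurable (torus d)"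
    using assms by (auto simp: L2_def)
  have "a * b \<le> a\<^sup>2 + b\<^sup>2" for a b :: real
    using sum_squares_bound[of a b] zero_le_power2[of a] zero_le_power2[of b] by linarith
  then show "AE z in torus d. norm (f z * cnj (g z)) \<le> norm ((cmod (f z))\<^sup>2 + (cmod (g z))\<^sup>2)"
    by (simp add: norm_mult)
qed

lemma L2_inner_cnj: "L2_inner d g f = cnj (L2_inner d f g)"
  unfolding L2_inner_def by (simp add: mult.commute flip: Bochner_Integration.integral_cnj)

lemma L2_inner_diff:
  "f \<in> L2 d \<Longrightarrow> g \<in> L2 d \<Longrightarrow> h \<in> L2 d \<Longrightarrow>
    L2_inner d (\<lambda>z. f z - g z) h = L2_inner d f h - L2_inner d g h"
  unfolding L2_inner_def by (simp add: left_diff_distrib L2_inner_integrable)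

lemma L2_inner_sum:
  assumes "\<And>i. i \<in> I \<Longrightarrow> f i \<in> L2 d" "g \<in> L2 d"
  shows "L2_inner d (\<lambda>z. \<Sum>i\<in>I. c i * f i z) g = (\<Sum>i\<in>I. c i * L2_inner d (f i) g)"
proof -
  have "L2_inner d (\<lambda>z. \<Sum>i\<in>I. c i * f i z) g = (LINT z|torus d. (\<Sum>i\<in>I. c i * (f i z * cnj (g z))))"
    by (simp add: L2_inner_def sum_distrib_right mult.assoc)
  also have "\<dots> = (\<Sum>i\<in>I. c i * L2_inner d (f i) g)"
    using assms by (subst Bochner_Integration.integral_sum) (auto simp: L2_inner_integrable L2_inner_def)
  finally show ?thesis .
qed

lemma L2_inner_self: "L2_inner d f f = of_real ((L2_norm d f)\<^sup>2)"
  unfolding L2_inner_def L2_norm_def complex_norm_square[symmetric] integral_complex_of_real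
  by (subst real_sqrt_pow2) auto

text \<open>\<open>hankel\<close> picks an arbitrary representative of the projection, so its norm
  must not depend on the choice. Both g and h have the same inner products with S as f, hence <g, g>
  = <h, g> = cnj <g, h> = cnj <h, h>.\<close>

lemma is_orth_proj_norm_unique:
  assumes g: "is_orth_proj d S f g" and h: "is_orth_proj d S f h"
    and S: "S \<subseteq> L2 d" and f: "f \<in> L2 d"
  shows "L2_norm d g = L2_norm d h"
proof -
  have gh: "g \<in> S" "h \<in> S" using g h by (auto simp: is_orth_proj_def)
  have *: "L2_inner d f u = L2_inner d v u" if "is_orth_proj d S f v" "u \<in> S" for u v
  proof -
    have "L2_inner d (\<lambda>z. f z - v z) u = 0" "v \<in> S" using that by (auto simp: is_orth_proj_def)
    then show ?thesis using L2_inner_diff[of f d v u] that S f by auto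
  qed
  have "L2_inner d g g = L2_inner d h g" using *[OF g gh(1)] *[OF h gh(1)] by simp
  also have "\<dots> = cnj (L2_inner d g h)" by (rule L2_inner_cnj)
  also have "L2_inner d g h = L2_inner d h h" using *[OF g gh(2)] *[OF h gh(2)] by simp
  finally have "(L2_norm d g)\<^sup>2 = (L2_norm d h)\<^sup>2"
    unfolding L2_inner_self by (simp only: complex_cnj_complex_of_real of_real_eq_iff)
  then show ?thesis
    by (auto simp: power2_eq_iff L2_norm_def)
qed

lemma monom_fun_L2: "monom_fun d k \<in> L2 d"
  by (rule L2_bounded[where b = 1]) (auto simp: norm_monom_fun)

lemma L2_inner_monom_fun:
  "L2_inner d (monom_fun d k) (monom_fun d l) = (if \<forall>j<d. k j = l j then 1 else 0)"
proof -
  have "L2_inner d (monom_fun d k) (monom_fun d l) = (LINT z|torus d. monom_fun d (\<lambda>j. k j + - l j) z)"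
    unfolding L2_inner_def
    by (rule Bochner_Integration.integral_cong) (simp_all only: cnj_monom_fun monom_fun_mult)
  then show ?thesis by (simp add: integral_monom_fun)
qed

definition poly_fun :: "nat \<Rightarrow> (nat \<Rightarrow> nat) set \<Rightarrow> ((nat \<Rightarrow> nat) \<Rightarrow> complex) \<Rightarrow> (nat \<Rightarrow> complex) \<Rightarrow> complex"
  where "poly_fun d K a z = (\<Sum>k\<in>K. a k * monom_fun d (\<lambda>j. int (k j)) z)"

lemma poly_fun_measurable [measurable]: "poly_fun d K a \<in> borel_measurable (torus d)"
  unfolding poly_fun_def by measurable

lemma norm_poly_fun_le: "z \<in> space (torus d) \<Longrightarrow> cmod (poly_fun d K a z) \<le> (\<Sum>k\<in>K. cmod (a k))"
  unfolding poly_fun_def by (rule sum_norm_le) (simp add: norm_mult norm_monom_fun)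

lemma poly_fun_L2: "poly_fun d K a \<in> L2 d"
  by (rule L2_bounded[OF poly_fun_measurable norm_poly_fun_le])

lemma L2_inner_poly_fun:
  "g \<in> L2 d \<Longrightarrow> L2_inner d (poly_fun d K a) g =
    (\<Sum>k\<in>K. a k * L2_inner d (monom_fun d (\<lambda>j. int (k j))) g)"
  unfolding poly_fun_def[abs_def] by (rule L2_inner_sum) (auto simp: monom_fun_L2)

lemma poly_fun_H2: "poly_fun d K a \<in> H2 d"
  unfolding H2_def fourier_coeff_alt
  by (auto simp: poly_fun_L2 L2_inner_poly_fun monom_fun_L2 L2_inner_monom_fun intro!: sum.neutral)
    force

lemma poly_fun_inner:
  assumes K: "finite K" "K \<subseteq> {..<d} \<rightarrow>\<^sub>E UNIV"
  shows "L2_inner d (poly_fun d K a) (poly_fun d K b) = (\<Sum>k\<in>K. a k * cnj (b k))"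
proof -
  have "L2_inner d (monom_fun d (\<lambda>j. int (k j))) (poly_fun d K b) = cnj (b k)" if "k \<in> K" for k
  proof -
    \<comment> \<open>Exponents in K are extensional on \<open>{..<d}\<close>, so distinct ones
      differ below d and their monomials are orthogonal.\<close>
    have eq: "(\<forall>j<d. l j = k j) \<longleftrightarrow> l = k" if "l \<in> K" for l
      using that \<open>k \<in> K\<close> K(2) by (auto intro!: PiE_ext[of l "{..<d}" "\<lambda>_. UNIV" k])
    have "L2_inner d (poly_fun d K b) (monom_fun d (\<lambda>j. int (k j))) = (\<Sum>l\<in>K. if l = k then b l else 0)"
      using eq by (auto simp: L2_inner_poly_fun monom_fun_L2 L2_inner_monom_fun intro!: sum.cong)
    also have "\<dots> = b k" using K(1) that by simp
    finally show ?thesis by (subst L2_inner_cnj) simp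
  qed
  then show ?thesis by (simp add: L2_inner_poly_fun poly_fun_L2)
qed

lemma poly_fun_norm:
  assumes "finite K" "K \<subseteq> {..<d} \<rightarrow>\<^sub>E UNIV"
  shows "(L2_norm d (poly_fun d K a))\<^sup>2 = (\<Sum>k\<in>K. (cmod (a k))\<^sup>2)"
proof -
  have "complex_of_real ((L2_norm d (poly_fun d K a))\<^sup>2) = of_real (\<Sum>k\<in>K. (cmod (a k))\<^sup>2)"
    unfolding L2_inner_self[symmetric] poly_fun_inner[OF assms]
    by (simp only: complex_norm_square of_real_sum)
  then show ?thesis by (simp only: of_real_eq_iff)
qed

text \<open>Exponent functions of an analytic polynomial may agree below d and differ elsewhere, and
  then give the same monomial. Restricting them to \<open>{..<d}\<close> and adding the coefficients
  that collide yields a representation to which \<open>poly_fun_norm\<close> applies.\<close>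

lemma analytic_polys_poly_fun:
  assumes "f \<in> analytic_polys d"
  obtains K a where "finite K" "K \<subseteq> {..<d} \<rightarrow>\<^sub>E UNIV" "f = poly_fun d K a"
proof -
  obtain K c where K: "finite K" and f: "f = (\<lambda>z. \<Sum>k\<in>K. c k * (\<Prod>j<d. z j ^ k j))"
    using assms by (auto simp: analytic_polys_def)
  let ?r = "\<lambda>k. restrict k {..<d}"
  define a where "a l = (\<Sum>k\<in>{k \<in> K. ?r k = l}. c k)" for l
  have "f z = poly_fun d (?r ` K) a z" for z
  proof -
    have "f z = (\<Sum>k\<in>K. c k * monom_fun d (\<lambda>j. int (?r k j)) z)"
      unfolding f monom_fun_def by (auto intro!: sum.cong prod.cong)
    also have "\<dots> = (\<Sum>l\<in>?r ` K. \<Sum>k\<in>{k \<in> K. ?r k = l}. c k * monom_fun d (\<lambda>j. int (?r k j)) z)"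
      by (rule sum.image_gen[OF K])
    also have "\<dots> = poly_fun d (?r ` K) a z"
      unfolding poly_fun_def a_def sum_distrib_right by (auto intro!: sum.cong)
    finally show ?thesis .
  qed
  moreover have "finite (?r ` K)" "?r ` K \<subseteq> {..<d} \<rightarrow>\<^sub>E UNIV"
    using K by (simp_all add: image_subset_iff restrict_PiE_iff)
  ultimately show ?thesis using that by blast
qed

lemma H2_conj_L2: "H2_conj d \<subseteq> L2 d"
  by (auto simp: H2_conj_def H2_def L2_def)

subsection \<open>Hankel operators with polynomial symbol\<close>

text \<open>In the conjugate of the product, the exponent e from \<open>M\<close> and k from
  \<open>a\<close> give the monomial with exponent e - k. The projection keeps those with n = e - k
  nonnegative, so the coefficient at n is the Hankel matrix \<open>M (n + k)\<close> applied to the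
  conjugates of \<open>a\<close>. The sum \<open>b\<close> also evaluates \<open>M\<close> outside
  the box, where \<open>zero\<close> applies.\<close>

lemma hankel_projection:
  fixes K :: "(nat \<Rightarrow> nat) set" and M a :: "(nat \<Rightarrow> nat) \<Rightarrow> complex" and N d :: nat
  defines "B \<equiv> {..<d} \<rightarrow>\<^sub>E {..N}"
  defines "b \<equiv> \<lambda>n. \<Sum>k\<in>K. M (restrict (\<lambda>j. n j + k j) {..<d}) * cnj (a k)"
  assumes zero: "\<And>e. e \<in> {..<d} \<rightarrow>\<^sub>E UNIV \<Longrightarrow> e \<notin> B \<Longrightarrow> M e = 0"
  shows "is_orth_proj d (H2_conj d) (\<lambda>z. cnj (poly_fun d B M z) * poly_fun d K a z)
    (\<lambda>z. cnj (poly_fun d B b z))"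
proof -
  let ?F = "\<lambda>z. cnj (poly_fun d B M z) * poly_fun d K a z"
  let ?g = "\<lambda>z. cnj (poly_fun d B b z)"
  have g: "?g \<in> H2_conj d" unfolding H2_conj_def using poly_fun_H2 by blast
  have F: "?F \<in> L2 d"
  proof (rule L2_bounded)
    show "cmod (?F z) \<le> (\<Sum>k\<in>B. cmod (M k)) * (\<Sum>k\<in>K. cmod (a k))" if "z \<in> space (torus d)" for z
      using norm_poly_fun_le[OF that] by (auto simp: norm_mult intro!: mult_mono sum_nonneg)
  qed measurable
  have "L2_inner d (\<lambda>z. ?F z - ?g z) (\<lambda>z. cnj (h z)) = 0" if h: "h \<in> H2 d" for h
  proof -
    \<comment> \<open>The conjugate of the \<open>p\<close>-th Fourier coefficient of \<open>h\<close>.\<close>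
    define c where "c p = L2_inner d (monom_fun d p) h" for p
    have hL: "h \<in> L2 d" and hL': "(\<lambda>z. cnj (h z)) \<in> L2 d"
      using h H2_conj_L2 by (auto simp: H2_def H2_conj_def)
    have c0: "c p = 0" if "j < d" "p j < 0" for p j
    proof -
      have "fourier_coeff d h p = 0" using h that unfolding H2_def by auto
      then show ?thesis unfolding c_def by (subst L2_inner_cnj) (simp add: fourier_coeff_alt)
    qed
    \<comment> \<open>This is the substitution e = n + k. Terms on the left with a negative entry of
      e - k vanish because h is in H2; terms on the right with n + k outside the box vanish by
      \<open>zero\<close>.\<close>
    have key: "(\<Sum>e\<in>B. M e * c (\<lambda>j. int (e j) - int (k j))) =
        (\<Sum>n\<in>B. M (restrict (\<lambda>j. n j + k j) {..<d}) * c (\<lambda>j. int (n j)))" if "k \<in> K" for k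
    proof -
      let ?ad = "\<lambda>n. restrict (\<lambda>j. n j + k j) {..<d}"
      let ?sb = "\<lambda>e. restrict (\<lambda>j. e j - k j) {..<d}"
      have ext: "restrict e {..<d} = e" if "e \<in> B" for e
        using that by (auto simp: B_def PiE_iff extensional_restrict)
      have sb: "?ad (?sb e) = e \<and> ?sb e \<in> B \<and> c (\<lambda>j. int (?sb e j)) = c (\<lambda>j. int (e j) - int (k j))"
        if e: "e \<in> B" "c (\<lambda>j. int (e j) - int (k j)) \<noteq> 0" for e
      proof -
        have le: "k j \<le> e j" if "j < d" for j
          using c0[OF that, of "\<lambda>j. int (e j) - int (k j)"] e(2) by force
        then have "?ad (?sb e) = restrict e {..<d}" by (intro restrict_ext) auto
        moreover have "e j - k j \<le> N" if "j < d" for j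
          using e(1) that by (auto simp: B_def PiE_iff intro: le_trans[OF diff_le_self])
        then have "?sb e \<in> B" by (auto simp: B_def restrict_PiE_iff)
        moreover have "c (\<lambda>j. int (?sb e j)) = c (\<lambda>j. int (e j) - int (k j))"
          unfolding c_def by (subst monom_fun_cong) (auto simp: le of_nat_diff)
        ultimately show ?thesis using ext[OF e(1)] by simp
      qed
      have ad: "?sb (?ad n) = n \<and> ?ad n \<in> B \<and> c (\<lambda>j. int (?ad n j) - int (k j)) = c (\<lambda>j. int (n j))"
        if n: "n \<in> B" "M (?ad n) \<noteq> 0" for n
      proof -
        have "?sb (?ad n) = restrict n {..<d}" by (intro restrict_ext) auto
        moreover have "?ad n \<in> B" using zero[of "?ad n"] n(2) by (auto simp: restrict_PiE_iff)
        moreover have "c (\<lambda>j. int (?ad n j) - int (k j)) = c (\<lambda>j. int (n j))"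
          unfolding c_def by (subst monom_fun_cong) auto
        ultimately show ?thesis using ext[OF n(1)] by simp
      qed
      have fin: "finite B" by (simp add: B_def finite_PiE)
      \<comment> \<open>Restricted to nonzero terms, truncated subtraction of k is genuine
        subtraction and so inverts addition of k.\<close>
      let ?S = "{e \<in> B. M e \<noteq> 0 \<and> c (\<lambda>j. int (e j) - int (k j)) \<noteq> 0}"
      let ?T = "{n \<in> B. M (?ad n) \<noteq> 0 \<and> c (\<lambda>j. int (n j)) \<noteq> 0}"
      have "(\<Sum>e\<in>B. M e * c (\<lambda>j. int (e j) - int (k j))) =
          (\<Sum>e\<in>?S. M e * c (\<lambda>j. int (e j) - int (k j)))"
        using fin by (intro sum.mono_neutral_right) auto
      also have "\<dots> = (\<Sum>n\<in>?T. M (?ad n) * c (\<lambda>j. int (n j)))"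
      proof (rule sum.reindex_bij_witness[where i = ?ad and j = ?sb])
        fix e assume "e \<in> ?S"
        then have *: "e \<in> B" "M e \<noteq> 0" "c (\<lambda>j. int (e j) - int (k j)) \<noteq> 0" by auto
        note sb[OF *(1,3)]
        with * show "?ad (?sb e) = e" "?sb e \<in> ?T"
          "M (?ad (?sb e)) * c (\<lambda>j. int (?sb e j)) = M e * c (\<lambda>j. int (e j) - int (k j))"
          by (simp_all del: restrict_apply)
      next
        fix n assume "n \<in> ?T"
        then have *: "n \<in> B" "M (?ad n) \<noteq> 0" "c (\<lambda>j. int (n j)) \<noteq> 0" by auto
        note ad[OF *(1,2)]
        with * show "?sb (?ad n) = n" "?ad n \<in> ?S" by (simp_all del: restrict_apply)
      qed
      also have "\<dots> = (\<Sum>n\<in>B. M (?ad n) * c (\<lambda>j. int (n j)))"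
        using fin by (intro sum.mono_neutral_left) auto
      finally show ?thesis .
    qed
    have "L2_inner d ?g (\<lambda>z. cnj (h z)) = cnj (L2_inner d (poly_fun d B b) h)"
      unfolding L2_inner_def by (simp flip: Bochner_Integration.integral_cnj)
    also have "L2_inner d (poly_fun d B b) h = (\<Sum>n\<in>B. b n * c (\<lambda>j. int (n j)))"
      by (simp add: L2_inner_poly_fun hL c_def)
    also have "\<dots> = (\<Sum>k\<in>K. cnj (a k) * (\<Sum>n\<in>B. M (restrict (\<lambda>j. n j + k j) {..<d}) * c (\<lambda>j. int (n j))))"
      unfolding b_def sum_distrib_left sum_distrib_right by (subst sum.swap) (simp add: mult_ac)
    finally have 1: "L2_inner d ?g (\<lambda>z. cnj (h z)) = cnj \<dots>" .
    \<comment> \<open>Conjugating turns the pairing with \<open>cnj h\<close> into one with h, whose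
      values on monomials are given by \<open>c\<close>.\<close>
    have "L2_inner d ?F (\<lambda>z. cnj (h z)) =
        cnj (L2_inner d (\<lambda>z. poly_fun d B M z * cnj (poly_fun d K a z)) h)"
      unfolding L2_inner_def by (simp flip: Bochner_Integration.integral_cnj)
    also have "L2_inner d (\<lambda>z. poly_fun d B M z * cnj (poly_fun d K a z)) h =
        L2_inner d (\<lambda>z. \<Sum>p\<in>B \<times> K. (M (fst p) * cnj (a (snd p))) *
          monom_fun d (\<lambda>j. int (fst p j) + - int (snd p j)) z) h"
      unfolding L2_inner_def
    proof (rule Bochner_Integration.integral_cong[OF refl])
      fix z assume z: "z \<in> space (torus d)"
      have "poly_fun d B M z * cnj (poly_fun d K a z) =
          (\<Sum>p\<in>B \<times> K. (M (fst p) * cnj (a (snd p))) *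
            (monom_fun d (\<lambda>j. int (fst p j)) z * cnj (monom_fun d (\<lambda>j. int (snd p j)) z)))"
        unfolding poly_fun_def cnj_sum sum_product sum.cartesian_product
        by (rule sum.cong) (auto simp: mult_ac)
      also have "\<dots> = (\<Sum>p\<in>B \<times> K. (M (fst p) * cnj (a (snd p))) *
          monom_fun d (\<lambda>j. int (fst p j) + - int (snd p j)) z)"
        by (simp only: cnj_monom_fun[OF z] monom_fun_mult[OF z])
      finally show "poly_fun d B M z * cnj (poly_fun d K a z) * cnj (h z) =
          (\<Sum>p\<in>B \<times> K. (M (fst p) * cnj (a (snd p))) *
            monom_fun d (\<lambda>j. int (fst p j) + - int (snd p j)) z) * cnj (h z)" by simp
    qed
    also have "\<dots> = (\<Sum>p\<in>B \<times> K. (M (fst p) * cnj (a (snd p))) *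
        c (\<lambda>j. int (fst p j) + - int (snd p j)))"
      unfolding c_def by (rule L2_inner_sum) (auto simp: monom_fun_L2 hL)
    also have "\<dots> = (\<Sum>e\<in>B. \<Sum>k\<in>K. cnj (a k) * (M e * c (\<lambda>j. int (e j) - int (k j))))"
      unfolding sum.cartesian_product by (auto simp: mult_ac intro!: sum.cong)
    also have "\<dots> = (\<Sum>k\<in>K. cnj (a k) * (\<Sum>e\<in>B. M e * c (\<lambda>j. int (e j) - int (k j))))"
      unfolding sum_distrib_left by (rule sum.swap)
    also have "\<dots> = (\<Sum>k\<in>K. cnj (a k) * (\<Sum>n\<in>B. M (restrict (\<lambda>j. n j + k j) {..<d}) * c (\<lambda>j. int (n j))))"
      by (rule sum.cong) (auto simp: key)
    finally show ?thesis
      using L2_inner_diff[OF F _ hL', of ?g] 1 g H2_conj_L2 by auto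
  qed
  then show ?thesis
    using g unfolding is_orth_proj_def H2_conj_def by auto
qed

subsection \<open>The extremal symbol\<close>

lemma pair_prod_cong: "(\<And>j. j < 2 * m \<Longrightarrow> e j = f j) \<Longrightarrow> pair_prod m F e = pair_prod m F f"
  unfolding pair_prod_def by (rule prod.cong) auto

text \<open>Inner products are computed from coefficients, the L1 norm from a product of functions.
  Distributivity passes from the first form to the second.\<close>

lemma poly_fun_pair_prod:
  "poly_fun (2 * m) ({..<2 * m} \<rightarrow>\<^sub>E A) (pair_prod m F) z =
    pair_prod m (\<lambda>u v. \<Sum>x\<in>A. \<Sum>y\<in>A. F x y * (u ^ x * v ^ y)) z"
proof -
  have "pair_prod m F e * monom_fun (2 * m) (\<lambda>j. int (e j)) z =
      (\<Prod>i<m. F (e (2 * i)) (e (2 * i + 1)) * (z (2 * i) ^ e (2 * i) * z (2 * i + 1) ^ e (2 * i + 1)))" for e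
    by (simp add: pair_prod_def monom_fun_def prod_even_odd prod.distrib)
  then show ?thesis
    unfolding poly_fun_def
    using sum_prod_pairs[where m = m and A = A
      and F = "\<lambda>i x y. F x y * (z (2 * i) ^ x * z (2 * i + 1) ^ y)"]
    by (simp add: pair_prod_def)
qed

text \<open>The coefficients of \<open>2x^2 + xy + 2y^2\<close>; as a function of exponents, its
  value at (x + p, y + q) is the Hankel matrix entry.\<close>

definition sym_coeff :: "nat \<Rightarrow> nat \<Rightarrow> real" where
  "sym_coeff x y = (if x + y = 2 then if x = 1 then 1 else 2 else 0)"

definition test_coeff :: "nat \<Rightarrow> nat \<Rightarrow> real" where
  "test_coeff x y = (if x + y = 2 then 1 else 0)"

text \<open>
  The Perron vector of the matrix \<open>sym_coeff (x + p) (y + q)\<close>, for the eigenvalue \<open>3\<close>; the values off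
  \<open>x + y \<le> 2\<close> only need to be positive.
\<close>

definition schur_weight :: "nat \<Rightarrow> nat \<Rightarrow> real" where
  "schur_weight x y = (if x + y = 0 then 3 else if x + y = 2 \<and> x \<noteq> 1 then 2 else 1)"

text \<open>Equality holds for p + q \<le> 2; at (0, 0), for instance, 2 * 2 + 1 * 1 + 2 * 2 = 3 *
  3. For p + q > 2 the left side is 0.\<close>

lemma schur_weight_row:
  "(\<Sum>x\<le>2. \<Sum>y\<le>2. sym_coeff (x + p) (y + q) * schur_weight x y) \<le> 3 * schur_weight p q"
proof (cases "p \<le> 2 \<and> q \<le> 2")
  case True
  then have "p \<in> {0, 1, 2}" "q \<in> {0, 1, 2}" by auto
  then show ?thesis
    by (auto simp: sym_coeff_def schur_weight_def numeral_2_eq_2)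
next
  case False
  then show ?thesis by (auto simp: sym_coeff_def schur_weight_def numeral_2_eq_2)
qed

definition symbol :: "nat \<Rightarrow> (nat \<Rightarrow> complex) \<Rightarrow> complex" where
  "symbol m = poly_fun (2 * m) ({..<2 * m} \<rightarrow>\<^sub>E {..2}) (\<lambda>e. of_real (pair_prod m sym_coeff e))"

definition test_fun :: "nat \<Rightarrow> (nat \<Rightarrow> complex) \<Rightarrow> complex" where
  "test_fun m = poly_fun (2 * m) ({..<2 * m} \<rightarrow>\<^sub>E {..2}) (\<lambda>e. of_real (pair_prod m test_coeff e))"

lemma of_real_pair_prod:
  "of_real (pair_prod m F e) = pair_prod m (\<lambda>x y. of_real (F x y)) e"
  by (simp add: pair_prod_def)

lemma test_fun_eq: "test_fun m z = pair_prod m (\<lambda>x y. x\<^sup>2 + x * y + y\<^sup>2) z"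
proof -
  have "(\<Sum>x\<le>2. \<Sum>y\<le>2. complex_of_real (test_coeff x y) * (u ^ x * v ^ y)) = u\<^sup>2 + u * v + v\<^sup>2" for u v
    by (simp add: test_coeff_def numeral_2_eq_2)
  then show ?thesis
    by (simp add: test_fun_def of_real_pair_prod poly_fun_pair_prod)
qed

lemma finite_box: "finite ({..<d} \<rightarrow>\<^sub>E {..N::nat})" for d :: nat
  by (simp add: finite_PiE)

lemma box_subset: "({..<d} \<rightarrow>\<^sub>E {..N::nat}) \<subseteq> {..<d} \<rightarrow>\<^sub>E UNIV" for d :: nat
  by (intro PiE_mono) auto

section \<open>Pairing, L1 norm and Hankel norm of the extremal functions\<close>

lemma symbol_test_inner: "L2_inner (2 * m) (symbol m) (test_fun m) = 5 ^ m"
proof -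
  have "L2_inner (2 * m) (symbol m) (test_fun m) =
      of_real (\<Sum>e\<in>{..<2 * m} \<rightarrow>\<^sub>E {..2}. \<Prod>i<m. sym_coeff (e (2 * i)) (e (2 * i + 1)) *
        test_coeff (e (2 * i)) (e (2 * i + 1)))"
    unfolding symbol_def test_fun_def poly_fun_inner[OF finite_box box_subset]
    by (simp add: pair_prod_def prod.distrib)
  also have "\<dots> = of_real ((\<Sum>x\<le>2. \<Sum>y\<le>2. sym_coeff x y * test_coeff x y) ^ m)"
    by (subst sum_prod_pairs) simp
  \<comment> \<open>The exponents (2, 0), (1, 1) and (0, 2) contribute 2 + 1 + 2.\<close>
  also have "(\<Sum>x\<le>2. \<Sum>y\<le>2. sym_coeff x y * test_coeff x y) = 5"
    by (simp add: sym_coeff_def test_coeff_def numeral_2_eq_2)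
  finally show ?thesis by simp
qed

lemma test_fun_L1:
  "(LINT z|torus (2 * m). cmod (test_fun m z)) = ((pi + 6 * sqrt 3) / (3 * pi)) ^ m"
proof -
  have *: "cmod (test_fun m z) = pair_prod m (\<lambda>x y. cmod (x\<^sup>2 + x * y + y\<^sup>2)) z" for m z
    by (simp add: test_fun_eq pair_prod_def prod_norm)
  have "pair_prod k (\<lambda>x y. cmod (x\<^sup>2 + x * y + y\<^sup>2)) \<in> borel_measurable (torus n)" if "2 * k \<le> n" for k n
    unfolding pair_prod_def
    using that
    by (intro borel_measurable_prod borel_measurable_norm borel_measurable_add borel_measurable_times
        borel_measurable_power torus_coord_measurable) auto
  then show ?thesis
    unfolding *
    \<comment> \<open>The bound 3 is the triangle inequality for three terms of modulus 1.\<close>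
    by (intro integral_torus_pair_prod[where b = 3] integral_circle_norm_quadratic)
      (auto simp: norm_mult norm_power intro!: norm_triangle_le add_mono[of _ 2 _ 1, simplified])
qed

text \<open>On coefficients the operator is the matrix \<open>A\<close> acting on the conjugates of
  \<open>a\<close>. Its entries are nonnegative, so moduli may be taken inside and the Schur test
  applies, with a product weight and constant \<open>3 ^ m\<close>. As \<open>A\<close> is
  symmetric, one weight serves rows and columns.\<close>

lemma hankel_symbol_norm_le:
  assumes f: "f \<in> analytic_polys (2 * m)"
  shows "L2_norm (2 * m) (hankel (2 * m) (symbol m) f) \<le> 3 ^ m * L2_norm (2 * m) f"
proof -
  let ?d = "2 * m" and ?B = "{..<2 * m} \<rightarrow>\<^sub>E {..2::nat}"
  let ?M = "\<lambda>e. pair_prod m sym_coeff e"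
  obtain K a where K: "finite K" "K \<subseteq> {..<?d} \<rightarrow>\<^sub>E UNIV" and f: "f = poly_fun ?d K a"
    using analytic_polys_poly_fun[OF f] by blast
  \<comment> \<open>An entry above 2 at position j spoils the condition x + y = 2 in the pair with
    index \<open>j div 2\<close>, so that factor is 0.\<close>
  have zero: "?M e = 0" if "e \<in> {..<?d} \<rightarrow>\<^sub>E UNIV" "e \<notin> ?B" for e
  proof -
    from that obtain j where j: "j < ?d" "2 < e j" by (auto simp: PiE_iff not_le)
    have "sym_coeff (e (2 * (j div 2))) (e (2 * (j div 2) + 1)) = 0"
      using j by (cases "even j") (auto simp: sym_coeff_def elim!: evenE oddE)
    then show ?thesis
      unfolding pair_prod_def using j by (intro prod_zero) (auto intro!: bexI[of _ "j div 2"])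
  qed
  define A where "A n k = ?M (\<lambda>j. n j + k j)" for n k
  have A: "?M (restrict (\<lambda>j. n j + k j) {..<?d}) = A n k" for n k
    unfolding A_def by (rule pair_prod_cong) auto
  have A0: "0 \<le> A n k" for n k
    unfolding A_def pair_prod_def by (intro prod_nonneg) (auto simp: sym_coeff_def)
  define w where "w = pair_prod m schur_weight"
  have w: "0 < w k" for k
    unfolding w_def pair_prod_def by (intro prod_pos) (auto simp: schur_weight_def)
  have col: "(\<Sum>n\<in>?B. A n k * w n) \<le> 3 ^ m * w k" for k
  proof -
    have "(\<Sum>n\<in>?B. A n k * w n) = (\<Sum>n\<in>?B. \<Prod>i<m.
        sym_coeff (n (2 * i) + k (2 * i)) (n (2 * i + 1) + k (2 * i + 1)) * schur_weight (n (2 * i)) (n (2 * i + 1)))"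
      by (simp add: A_def w_def pair_prod_def prod.distrib)
    also have "\<dots> = (\<Prod>i<m. \<Sum>x\<le>2. \<Sum>y\<le>2.
        sym_coeff (x + k (2 * i)) (y + k (2 * i + 1)) * schur_weight x y)"
      by (rule sum_prod_pairs)
    also have "\<dots> \<le> (\<Prod>i<m. 3 * schur_weight (k (2 * i)) (k (2 * i + 1)))"
      by (intro prod_mono conjI schur_weight_row sum_nonneg) (auto simp: sym_coeff_def schur_weight_def)
    also have "\<dots> = 3 ^ m * w k"
      by (simp add: w_def pair_prod_def prod.distrib)
    finally show ?thesis .
  qed
  \<comment> \<open>K is arbitrary, but exponents outside the box contribute 0, and enlarging to the
    whole box only adds nonnegative terms. Symmetry of \<open>A\<close> then reduces the row sum to
    \<open>col\<close>.\<close>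
  have row: "(\<Sum>k\<in>K. A n k * w k) \<le> 3 ^ m * w n" for n
  proof -
    have "A n k = 0" if k: "k \<in> K" "k \<notin> ?B" for k
    proof -
      from k K obtain j where "j < ?d" "2 < k j" by (force simp: PiE_iff not_le)
      then have "restrict (\<lambda>j. n j + k j) {..<?d} \<notin> ?B"
        by (force simp: restrict_PiE_iff not_le)
      then show ?thesis using zero[of "restrict (\<lambda>j. n j + k j) {..<?d}"]
        by (simp add: A restrict_PiE_iff)
    qed
    then have "(\<Sum>k\<in>K. A n k * w k) = (\<Sum>k\<in>K \<inter> ?B. A n k * w k)"
      using K by (intro sum.mono_neutral_right) auto
    also have "\<dots> \<le> (\<Sum>k\<in>?B. A n k * w k)"
      using A0 w by (intro sum_mono2 finite_box) (auto simp: less_imp_le)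
    also have "\<dots> = (\<Sum>k\<in>?B. A k n * w k)"
      by (simp add: A_def add.commute)
    finally show ?thesis using col[of n] by simp
  qed
  define b where "b n = (\<Sum>k\<in>K. complex_of_real (?M (restrict (\<lambda>j. n j + k j) {..<?d})) * cnj (a k))" for n
  let ?F = "\<lambda>z. cnj (symbol m z) * f z"
  have proj: "is_orth_proj ?d (H2_conj ?d) ?F (\<lambda>z. cnj (poly_fun ?d ?B b z))"
    unfolding symbol_def f b_def[abs_def]
    by (rule hankel_projection) (simp add: zero)
  have "?F \<in> L2 ?d"
  proof (rule L2_bounded)
    show "?F \<in> borel_measurable (torus ?d)" unfolding symbol_def f by measurable
    show "cmod (?F z) \<le> (\<Sum>k\<in>?B. cmod (complex_of_real (?M k))) * (\<Sum>k\<in>K. cmod (a k))"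
      if "z \<in> space (torus ?d)" for z
      unfolding symbol_def f using norm_poly_fun_le[OF that]
      by (auto simp: norm_mult simp del: norm_of_real intro!: mult_mono sum_nonneg)
  qed
  then have "L2_norm ?d (hankel ?d (symbol m) f) = L2_norm ?d (\<lambda>z. cnj (poly_fun ?d ?B b z))"
    unfolding hankel_def
    by (intro is_orth_proj_norm_unique[OF someI[of "is_orth_proj ?d (H2_conj ?d) ?F", OF proj] proj H2_conj_L2])
  also have "\<dots> = L2_norm ?d (poly_fun ?d ?B b)"
    by (simp add: L2_norm_def)
  finally have "(L2_norm ?d (hankel ?d (symbol m) f))\<^sup>2 = (\<Sum>n\<in>?B. (cmod (b n))\<^sup>2)"
    by (simp add: poly_fun_norm[OF finite_box box_subset])
  also have "\<dots> \<le> (\<Sum>n\<in>?B. (\<Sum>k\<in>K. A n k * cmod (a k))\<^sup>2)"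
    unfolding b_def A
    by (intro sum_mono power_mono sum_norm_le) (auto simp: norm_mult A0)
  also have "\<dots> \<le> (3 ^ m)\<^sup>2 * (\<Sum>k\<in>K. (cmod (a k))\<^sup>2)"
    by (rule schur_test[where v = w and w = w]) (auto simp: A0 w col row)
  also have "\<dots> = (3 ^ m * L2_norm ?d f)\<^sup>2"
    by (simp add: f poly_fun_norm[OF K] power_mult_distrib)
  finally show ?thesis
    by (rule power2_le_imp_le) (simp add: L2_norm_def)
qed

text \<open>Duality: the test function lies in H2, so \<psi> and its projection have the same inner
  product \<open>5 ^ m\<close> with it, and this is at most the sup norm of \<psi> times the L1 norm
  of the test function.\<close>

lemma min_symbol_norm_symbol_ge:
  "ennreal ((5 / ((pi + 6 * sqrt 3) / (3 * pi))) ^ m) \<le> min_symbol_norm (2 * m) (symbol m)"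
  unfolding min_symbol_norm_def
proof (rule INF_greatest, clarify)
  let ?d = "2 * m"
  fix \<psi> assume \<psi>: "\<psi> \<in> Linf ?d" and proj: "is_orth_proj ?d (H2 ?d) \<psi> (symbol m)"
  interpret prob_space "torus ?d" by (rule prob_space_torus)
  define c where "c = (pi + 6 * sqrt 3) / (3 * pi)"
  have c: "0 < c" by (simp add: c_def add_pos_nonneg)
  define r where "r = enn2real (Linf_norm ?d \<psi>)"
  have r: "Linf_norm ?d \<psi> = ennreal r"
    using \<psi> by (simp add: r_def Linf_def)
  have meas [measurable]: "\<psi> \<in> borel_measurable (torus ?d)" using \<psi> by (simp add: Linf_def)
  have ae: "AE z in torus ?d. cmod (\<psi> z) \<le> r"
    using esssup_AE[of "\<lambda>z. ennreal (cmod (\<psi> z))" "torus ?d"]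
    unfolding Linf_norm_def[symmetric] r by eventually_elim (simp add: r_def)
  have tm [measurable]: "test_fun m \<in> borel_measurable (torus ?d)"
    unfolding test_fun_def by measurable
  have t2: "test_fun m \<in> L2 ?d" unfolding test_fun_def by (rule poly_fun_L2)
  have \<psi>2: "\<psi> \<in> L2 ?d"
    unfolding L2_def using ae
    by (auto intro!: integrable_const_bound[where B = "r\<^sup>2"] power_mono elim!: eventually_mono)
  have "test_fun m \<in> H2 ?d" unfolding test_fun_def by (rule poly_fun_H2)
  then have "L2_inner ?d (\<lambda>z. \<psi> z - symbol m z) (test_fun m) = 0"
    using proj by (auto simp: is_orth_proj_def)
  then have "L2_inner ?d \<psi> (test_fun m) = 5 ^ m"
    using L2_inner_diff[OF \<psi>2 _ t2, of "symbol m"] symbol_test_inner[of m]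
    by (simp add: symbol_def poly_fun_L2)
  then have "5 ^ m = cmod (LINT z|torus ?d. \<psi> z * cnj (test_fun m z))"
    by (simp add: L2_inner_def norm_power)
  also have "\<dots> \<le> (LINT z|torus ?d. r * cmod (test_fun m z))"
  proof (rule order_trans[OF integral_norm_bound integral_mono_AE])
    show "integrable (torus ?d) (\<lambda>z. norm (\<psi> z * cnj (test_fun m z)))"
      by (rule integrable_norm[OF L2_inner_integrable[OF \<psi>2 t2]])
    have "integrable (torus ?d) (test_fun m)"
      unfolding test_fun_def by (rule integrable_torus_bounded[OF poly_fun_measurable norm_poly_fun_le])
    then show "integrable (torus ?d) (\<lambda>z. r * cmod (test_fun m z))" by simp
    show "AE z in torus ?d. norm (\<psi> z * cnj (test_fun m z)) \<le> r * cmod (test_fun m z)"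
      using ae by eventually_elim (simp add: norm_mult mult_right_mono)
  qed
  also have "\<dots> = r * c ^ m" by (simp add: test_fun_L1 c_def)
  finally have "(5 / c) ^ m \<le> r"
    using c by (simp add: power_divide field_simps)
  then show "ennreal ((5 / ((pi + 6 * sqrt 3) / (3 * pi))) ^ m) \<le> Linf_norm ?d \<psi>"
    unfolding r c_def by (rule ennreal_leI)
qed

section \<open>The lower bound for the constant\<close>

theorem theorem5:
  fixes d :: nat
  assumes "d \<ge> 1" and "even d"
  shows "nehari_const d \<ge> ennreal ((5 * pi / (pi + 6 * sqrt 3)) ^ (d div 2))"
proof -
  define m where "m = d div 2"
  have d: "d = 2 * m" using assms(2) by (simp add: m_def)
  have hank: "hankel_norm d (symbol m) \<le> ennreal (3 ^ m)"
    unfolding hankel_norm_def d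
    by (rule SUP_least) (auto intro!: ennreal_leI dest!: hankel_symbol_norm_le)
  \<comment> \<open>The inequality constrains C only at symbols with finite Hankel norm.\<close>
  have finite: "hankel_norm d (symbol m) < \<infinity>"
    using le_less_trans[OF hank, of \<infinity>] by simp
  have H2: "symbol m \<in> H2 d" unfolding d symbol_def by (rule poly_fun_H2)
  define q where "q = 5 * pi / (pi + 6 * sqrt 3)"
  have q: "0 \<le> q" by (simp add: q_def)
  \<comment> \<open>Each pair contributes 3q to the lower bound for the symbol norm and 3 to the
    upper bound for the Hankel norm, which leaves the ratio q.\<close>
  have eq: "5 / ((pi + 6 * sqrt 3) / (3 * pi)) = q * 3" by (simp add: q_def)
  show ?thesis
    unfolding nehari_const_def m_def[symmetric] q_def[symmetric]
  proof (intro Inf_greatest, clarify)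
    fix C :: ennreal
    assume "\<forall>\<phi>\<in>H2 d. hankel_norm d \<phi> < \<infinity> \<longrightarrow> min_symbol_norm d \<phi> \<le> C * hankel_norm d \<phi>"
    with H2 finite have "min_symbol_norm d (symbol m) \<le> C * hankel_norm d (symbol m)"
      by blast
    also have "\<dots> \<le> C * ennreal (3 ^ m)" by (rule mult_left_mono[OF hank]) simp
    finally have le: "ennreal ((q * 3) ^ m) \<le> C * ennreal (3 ^ m)"
      using min_symbol_norm_symbol_ge[of m] unfolding eq d by (rule order_trans[rotated])
    show "ennreal (q ^ m) \<le> C"
    \<comment> \<open>Cancelling \<open>3 ^ m\<close> is done for real C; the infinite value
      satisfies the bound trivially.\<close>
    proof (cases C)
      case (real r)
      then have "ennreal (q ^ m * 3 ^ m) \<le> ennreal (r * 3 ^ m)"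
        using le by (simp add: ennreal_mult power_mult_distrib)
      then show ?thesis using real q by (auto intro!: ennreal_leI)
    qed simp
  qed
qed

end
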